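(* Let $(\mathfrak g,\cdot_{\mathfrak g},\mathfrak B,N)$ be a pseudo-Hessian-Nijenhuis pre-Lie algebra. Then there exists a pair of compatible invertible $\mathfrak s$-matrices $r_1,r_2$ in $(\mathfrak g,\cdot_{\mathfrak g})$ producing $(\mathfrak B,N)$, i.e. such that $N=r_1^\sharp\circ(r_2^\sharp)^{-1}$ and $\mathfrak B(x,y)=\langle x,(r_1^\sharp)^{-1}(y)\rangle$ for all $x,y\in\mathfrak g$.
   Context: $\mathbb K$ is an algebraically closed field of characteristic $0$; vector spaces are finite dimensional over $\mathbb K$. A pre-Lie algebra is a vector space $\mathfrak g$ with a bilinear product $\cdot_{\mathfrak g}$ such that $(x\cdot_{\mathfrak g} y)\cdot_{\mathfrak g} z-x\cdot_{\mathfrak g}(y\cdot_{\mathfrak g} z)$ is symmetric in $x,y$; $[x,y]^c=x\cdot_{\mathfrak g}y-y\cdot_{\mathfrak g}x$. For $r\in\mathrm{Sym}^2(\mathfrak g)$, $r^\sharp:\mathfrak g^*\to\mathfrak g$ is given by $\langle r^\sharp(\xi),\eta\rangle=r(\xi,\eta)$; $r$ is invertible if $r^\sharp$ is an isomorphism. For $r_1,r_2\in\mathrm{Sym}^2(\mathfrak g)$ and $\xi,\eta,\zeta\in\mathfrak g^*$ put \begin{align*}\llbracket r_1,r_2\rrbracket(\xi,\eta,\zeta)=\tfrac12\big(&-\langle\xi,r_1^\sharp(\eta)\cdot_{\mathfrak g}r_2^\sharp(\zeta)+r_2^\sharp(\eta)\cdot_{\mathfrak g}r_1^\sharp(\zeta)\rangle+\langle\eta,r_1^\sharp(\xi)\cdot_{\mathfrak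 g}r_2^\sharp(\zeta)+r_2^\sharp(\xi)\cdot_{\mathfrak g}r_1^\sharp(\zeta)\rangle\\&+\langle\zeta,[r_1^\sharp(\xi),r_2^\sharp(\eta)]^c+[r_2^\sharp(\xi),r_1^\sharp(\eta)]^c\rangle\big).\end{align*} An $\mathfrak s$-matrix is $r\in\mathrm{Sym}^2(\mathfrak g)$ with $\llbracket r,r\rrbracket=0$. Two $\mathfrak s$-matrices $r_1,r_2$ are compatible if $\llbracket r_1,r_2\rrbracket=0$. A linear map $N:\mathfrak g\to\mathfrak g$ is a Nijenhuis operator if $N(x)\cdot_{\mathfrak g}N(y)=N\big(N(x)\cdot_{\mathfrak g}y+x\cdot_{\mathfrak g}N(y)-N(x\cdot_{\mathfrak g}y)\big)$ for all $x,y$. A symmetric bilinear form $\mathfrak B$ on $\mathfrak g$ is closed if $\mathfrak B(x\cdot_{\mathfrak g}y,z)-\mathfrak B(x,y\cdot_{\mathfrak g}z)=\mathfrak B(y\cdot_{\mathfrak g}x,z)-\mathfrak B(y,x\cdot_{\mathfrak g}z)$ for all $x,y,z$; a pseudo-Hessian structure is a nondegenerate closed symmetric bilinear form. $(\mathfrak g,\cdot_{\mathfrak g},\mathfrak B,N)$ is a pseudo-Hessian-Nijenhuis pre-Lie algebra if $\mathfrak B$ is a pseudo-Hessian structure, $N$ is an invertible Nijenhuis operator, $\mathfrak B(N(x),y)=\mathfrak B(x,N(y))$ for all $x,y$, and $\mathfrak B_1(x,y)=\mathfrak B(x,N(y))$ is closed. *)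

theory Defs
  imports "HOL-Computational_Algebra.Polynomial"
begin

definition dual :: "('k::field \<Rightarrow> 'v::ab_group_add \<Rightarrow> 'v) \<Rightarrow> ('v \<Rightarrow> 'k) set" where
  "dual scale = {\<xi>. Vector_Spaces.linear scale (*) \<xi>}"

definition bilinear_product ::
  "('k::field \<Rightarrow> 'v::ab_group_add \<Rightarrow> 'v) \<Rightarrow> ('v \<Rightarrow> 'v \<Rightarrow> 'v) \<Rightarrow> bool" where
  "bilinear_product scale pmul \<longleftrightarrow>
     (\<forall>x. Vector_Spaces.linear scale scale (\<lambda>y. pmul x y)) \<and>
     (\<forall>y. Vector_Spaces.linear scale scale (\<lambda>x. pmul x y))"

definition bilinear_form ::
  "('k::field \<Rightarrow> 'v::ab_group_add \<Rightarrow> 'v) \<Rightarrow> ('v \<Rightarrow> 'v \<Rightarrow> 'k) \<Rightarrow> bool" where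
  "bilinear_form scale B \<longleftrightarrow>
     (\<forall>x. Vector_Spaces.linear scale (*) (\<lambda>y. B x y)) \<and>
     (\<forall>y. Vector_Spaces.linear scale (*) (\<lambda>x. B x y))"

definition symmetric_form :: "('v \<Rightarrow> 'v \<Rightarrow> 'k) \<Rightarrow> bool" where
  "symmetric_form B \<longleftrightarrow> (\<forall>x y. B x y = B y x)"

definition nondegenerate :: "('v::ab_group_add \<Rightarrow> 'v \<Rightarrow> 'k::field) \<Rightarrow> bool" where
  "nondegenerate B \<longleftrightarrow> (\<forall>x. (\<forall>y. B x y = 0) \<longrightarrow> x = 0)"

text \<open>The finite dimensional space is the whole type \<open>'v\<close>; \<open>Basis\<close> is an auxiliary basis
  required by the library locale; no condition refers to it.\<close>

locale pre_lie_algebra = finite_dimensional_vector_space scale Basis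
  for scale :: "'k::field \<Rightarrow> 'v::ab_group_add \<Rightarrow> 'v" and Basis :: "'v set" +
  fixes pmul :: "'v \<Rightarrow> 'v \<Rightarrow> 'v"
  assumes bilinear: "bilinear_product scale pmul"
    and left_symmetric:
      "pmul (pmul x y) z - pmul x (pmul y z) = pmul (pmul y x) z - pmul y (pmul x z)"

definition commutator :: "('v::ab_group_add \<Rightarrow> 'v \<Rightarrow> 'v) \<Rightarrow> 'v \<Rightarrow> 'v \<Rightarrow> 'v" where
  "commutator pmul x y = pmul x y - pmul y x"

text \<open>As $\mathfrak g$ is finite dimensional, an element of $\mathrm{Sym}^2(\mathfrak g)$ is a symmetric
  bilinear form on the dual space. Its values off \<open>dual scale\<close> are irrelevant.\<close>

definition Sym2 ::
  "('k::field \<Rightarrow> 'v::ab_group_add \<Rightarrow> 'v) \<Rightarrow> (('v \<Rightarrow> 'k) \<Rightarrow> ('v \<Rightarrow> 'k) \<Rightarrow> 'k) set" where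
  "Sym2 scale = {r.
     (\<forall>\<xi>\<in>dual scale. \<forall>\<eta>\<in>dual scale. r \<xi> \<eta> = r \<eta> \<xi>) \<and>
     (\<forall>\<xi>\<in>dual scale. \<forall>\<eta>\<in>dual scale. \<forall>\<zeta>\<in>dual scale.
        r \<xi> (\<lambda>v. \<eta> v + \<zeta> v) = r \<xi> \<eta> + r \<xi> \<zeta>) \<and>
     (\<forall>\<xi>\<in>dual scale. \<forall>\<eta>\<in>dual scale. \<forall>c. r \<xi> (\<lambda>v. c * \<eta> v) = c * r \<xi> \<eta>)}"

text \<open>The map $r^\sharp$ from the dual of $\mathfrak g$ to $\mathfrak g$; the description denotes for \<open>r \<in> Sym2 scale\<close>
  and \<open>\<xi> \<in> dual scale\<close>, see \<open>r_sharp_eq\<close> below.\<close>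

definition r_sharp ::
  "('k::field \<Rightarrow> 'v::ab_group_add \<Rightarrow> 'v) \<Rightarrow> (('v \<Rightarrow> 'k) \<Rightarrow> ('v \<Rightarrow> 'k) \<Rightarrow> 'k)
     \<Rightarrow> ('v \<Rightarrow> 'k) \<Rightarrow> 'v" where
  "r_sharp scale r \<xi> = (THE x. \<forall>\<eta>\<in>dual scale. \<eta> x = r \<xi> \<eta>)"

definition invertible_Sym2 ::
  "('k::field \<Rightarrow> 'v::ab_group_add \<Rightarrow> 'v) \<Rightarrow> (('v \<Rightarrow> 'k) \<Rightarrow> ('v \<Rightarrow> 'k) \<Rightarrow> 'k) \<Rightarrow> bool" where
  "invertible_Sym2 scale r \<longleftrightarrow> bij_betw (r_sharp scale r) (dual scale) UNIV"

definition r_sharp_inv ::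
  "('k::field \<Rightarrow> 'v::ab_group_add \<Rightarrow> 'v) \<Rightarrow> (('v \<Rightarrow> 'k) \<Rightarrow> ('v \<Rightarrow> 'k) \<Rightarrow> 'k)
     \<Rightarrow> 'v \<Rightarrow> ('v \<Rightarrow> 'k)" where
  "r_sharp_inv scale r = inv_into (dual scale) (r_sharp scale r)"

definition s_bracket ::
  "('k::field \<Rightarrow> 'v::ab_group_add \<Rightarrow> 'v) \<Rightarrow> ('v \<Rightarrow> 'v \<Rightarrow> 'v)
     \<Rightarrow> (('v \<Rightarrow> 'k) \<Rightarrow> ('v \<Rightarrow> 'k) \<Rightarrow> 'k) \<Rightarrow> (('v \<Rightarrow> 'k) \<Rightarrow> ('v \<Rightarrow> 'k) \<Rightarrow> 'k)
     \<Rightarrow> ('v \<Rightarrow> 'k) \<Rightarrow> ('v \<Rightarrow> 'k) \<Rightarrow> ('v \<Rightarrow> 'k) \<Rightarrow> 'k" where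
  "s_bracket scale pmul r1 r2 \<xi> \<eta> \<zeta> =
     (let s1 = r_sharp scale r1; s2 = r_sharp scale r2 in
      (1 / 2) *
        (- \<xi> (pmul (s1 \<eta>) (s2 \<zeta>) + pmul (s2 \<eta>) (s1 \<zeta>))
         + \<eta> (pmul (s1 \<xi>) (s2 \<zeta>) + pmul (s2 \<xi>) (s1 \<zeta>))
         + \<zeta> (commutator pmul (s1 \<xi>) (s2 \<eta>) + commutator pmul (s2 \<xi>) (s1 \<eta>))))"

definition s_matrix ::
  "('k::field \<Rightarrow> 'v::ab_group_add \<Rightarrow> 'v) \<Rightarrow> ('v \<Rightarrow> 'v \<Rightarrow> 'v)
     \<Rightarrow> (('v \<Rightarrow> 'k) \<Rightarrow> ('v \<Rightarrow> 'k) \<Rightarrow> 'k) \<Rightarrow> bool" where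
  "s_matrix scale pmul r \<longleftrightarrow> r \<in> Sym2 scale \<and>
     (\<forall>\<xi>\<in>dual scale. \<forall>\<eta>\<in>dual scale. \<forall>\<zeta>\<in>dual scale. s_bracket scale pmul r r \<xi> \<eta> \<zeta> = 0)"

definition compatible_s_matrices ::
  "('k::field \<Rightarrow> 'v::ab_group_add \<Rightarrow> 'v) \<Rightarrow> ('v \<Rightarrow> 'v \<Rightarrow> 'v)
     \<Rightarrow> (('v \<Rightarrow> 'k) \<Rightarrow> ('v \<Rightarrow> 'k) \<Rightarrow> 'k) \<Rightarrow> (('v \<Rightarrow> 'k) \<Rightarrow> ('v \<Rightarrow> 'k) \<Rightarrow> 'k) \<Rightarrow> bool" where
  "compatible_s_matrices scale pmul r1 r2 \<longleftrightarrow>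
     s_matrix scale pmul r1 \<and> s_matrix scale pmul r2 \<and>
     (\<forall>\<xi>\<in>dual scale. \<forall>\<eta>\<in>dual scale. \<forall>\<zeta>\<in>dual scale. s_bracket scale pmul r1 r2 \<xi> \<eta> \<zeta> = 0)"

definition nijenhuis_operator ::
  "('k::field \<Rightarrow> 'v::ab_group_add \<Rightarrow> 'v) \<Rightarrow> ('v \<Rightarrow> 'v \<Rightarrow> 'v) \<Rightarrow> ('v \<Rightarrow> 'v) \<Rightarrow> bool" where
  "nijenhuis_operator scale pmul N \<longleftrightarrow> Vector_Spaces.linear scale scale N \<and>
     (\<forall>x y. pmul (N x) (N y) = N (pmul (N x) y + pmul x (N y) - N (pmul x y)))"

definition closed_form ::
  "('v \<Rightarrow> 'v \<Rightarrow> 'v) \<Rightarrow> ('v \<Rightarrow> 'v \<Rightarrow> 'k::field) \<Rightarrow> bool" where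
  "closed_form pmul B \<longleftrightarrow>
     (\<forall>x y z. B (pmul x y) z - B x (pmul y z) = B (pmul y x) z - B y (pmul x z))"

definition pseudo_hessian_structure ::
  "('k::field \<Rightarrow> 'v::ab_group_add \<Rightarrow> 'v) \<Rightarrow> ('v \<Rightarrow> 'v \<Rightarrow> 'v) \<Rightarrow> ('v \<Rightarrow> 'v \<Rightarrow> 'k) \<Rightarrow> bool" where
  "pseudo_hessian_structure scale pmul B \<longleftrightarrow>
     bilinear_form scale B \<and> symmetric_form B \<and> nondegenerate B \<and> closed_form pmul B"

locale pseudo_hessian_nijenhuis_pre_lie_algebra = pre_lie_algebra scale Basis pmul
  for scale :: "'k::field \<Rightarrow> 'v::ab_group_add \<Rightarrow> 'v" and Basis :: "'v set"
    and pmul :: "'v \<Rightarrow> 'v \<Rightarrow> 'v" +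
  fixes B :: "'v \<Rightarrow> 'v \<Rightarrow> 'k" and N :: "'v \<Rightarrow> 'v"
  assumes pseudo_hessian: "pseudo_hessian_structure scale pmul B"
    and nijenhuis: "nijenhuis_operator scale pmul N"
    and invertible: "bij N"
    and self_adjoint: "B (N x) y = B x (N y)"
    and closed_B1: "closed_form pmul (\<lambda>x y. B x (N y))"

context finite_dimensional_vector_space
begin

lemma dualD:
  assumes "\<xi> \<in> dual scale"
  shows "\<xi> (x + y) = \<xi> x + \<xi> y" "\<xi> (scale c x) = c * \<xi> x" "\<xi> 0 = 0"
proof -
  interpret l: Vector_Spaces.linear scale "(*)" \<xi>
    using assms by (simp add: dual_def)
  show "\<xi> (x + y) = \<xi> x + \<xi> y" "\<xi> (scale c x) = c * \<xi> x" "\<xi> 0 = 0"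
    by (fact l.add l.scale l.zero)+
qed

lemma dualI:
  assumes "\<And>x y. \<xi> (x + y) = \<xi> x + \<xi> y" "\<And>c x. \<xi> (scale c x) = c * \<xi> x"
  shows "\<xi> \<in> dual scale"
proof -
  have "vector_space ((*) :: 'a \<Rightarrow> 'a \<Rightarrow> 'a)"
    by unfold_locales (simp_all add: algebra_simps)
  then show ?thesis
    using assms vector_space_axioms by (simp add: dual_def Vector_Spaces.linear_iff)
qed

lemma dual_sum_scale:
  assumes "\<xi> \<in> dual scale" "finite A"
  shows "\<xi> (\<Sum>b\<in>A. scale (c b) b) = (\<Sum>b\<in>A. c b * \<xi> b)"
  using assms(2) by induction (simp_all add: dualD[OF assms(1)])

lemma coord_dual: "(\<lambda>v. representation Basis v b) \<in> dual scale"
  by (rule dualI)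
    (simp_all add: representation_add representation_scale independent_Basis span_Basis)

lemma basis_expansion: "(\<Sum>b\<in>Basis. scale (representation Basis v b) b) = v"
  by (rule sum_representation_eq) (simp_all add: independent_Basis span_Basis finite_Basis)

lemma dual_separates:
  assumes "\<And>\<eta>. \<eta> \<in> dual scale \<Longrightarrow> \<eta> x = \<eta> y"
  shows "x = y"
proof -
  have "representation Basis x b = representation Basis y b" for b
    by (rule assms[OF coord_dual])
  then have "(\<Sum>b\<in>Basis. scale (representation Basis x b) b) =
      (\<Sum>b\<in>Basis. scale (representation Basis y b) b)"
    by (simp only:)
  then show ?thesis by (simp only: basis_expansion)
qed

lemma Sym2_sum:
  assumes r: "r \<in> Sym2 scale" "\<xi> \<in> dual scale" and "finite A"
    and f: "\<And>b. b \<in> A \<Longrightarrow> f b \<in> dual scale"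
  shows "(\<lambda>v. \<Sum>b\<in>A. c b * f b v) \<in> dual scale \<and>
    r \<xi> (\<lambda>v. \<Sum>b\<in>A. c b * f b v) = (\<Sum>b\<in>A. c b * r \<xi> (f b))"
  using assms(3) f
proof (induction A)
  case empty
  have z: "(\<lambda>v. 0) \<in> dual scale" by (rule dualI) simp_all
  have "\<forall>\<eta>\<in>dual scale. \<forall>c. r \<xi> (\<lambda>v. c * \<eta> v) = c * r \<xi> \<eta>"
    using r by (simp add: Sym2_def)
  from this[rule_format, OF z, of 0] z show ?case by simp
next
  case (insert a A)
  let ?g = "\<lambda>v. \<Sum>b\<in>A. c b * f b v"
  have g: "?g \<in> dual scale" "r \<xi> ?g = (\<Sum>b\<in>A. c b * r \<xi> (f b))"
    using insert by auto
  have fa: "f a \<in> dual scale" using insert by simp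
  have h: "(\<lambda>v. c a * f a v) \<in> dual scale"
    by (rule dualI) (simp_all add: dualD[OF fa] algebra_simps)
  have add: "\<forall>\<xi>\<in>dual scale. \<forall>\<eta>\<in>dual scale. \<forall>\<zeta>\<in>dual scale.
      r \<xi> (\<lambda>v. \<eta> v + \<zeta> v) = r \<xi> \<eta> + r \<xi> \<zeta>"
    using r(1) by (simp add: Sym2_def)
  have "(\<lambda>v. c a * f a v + ?g v) \<in> dual scale"
    by (rule dualI) (simp_all only: dualD[OF g(1)] dualD[OF h] algebra_simps)
  moreover have "r \<xi> (\<lambda>v. c a * f a v + ?g v) = r \<xi> (\<lambda>v. c a * f a v) + r \<xi> ?g"
    using add[rule_format, OF r(2) h g(1)] .
  moreover have "r \<xi> (\<lambda>v. c a * f a v) = c a * r \<xi> (f a)"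
    using r fa unfolding Sym2_def by blast
  ultimately show ?case using insert.hyps g(2) by simp
qed

lemma r_sharp_eq:
  assumes r: "r \<in> Sym2 scale" "\<xi> \<in> dual scale" and \<eta>: "\<eta> \<in> dual scale"
  shows "\<eta> (r_sharp scale r \<xi>) = r \<xi> \<eta>"
proof -
  let ?f = "\<lambda>b v. representation Basis v b"
  let ?x = "\<Sum>b\<in>Basis. scale (r \<xi> (?f b)) b"
  have x: "\<forall>\<eta>\<in>dual scale. \<eta> ?x = r \<xi> \<eta>"
  proof
    fix \<eta> :: "'b \<Rightarrow> 'a" assume \<eta>: "\<eta> \<in> dual scale"
    have "\<eta> v = (\<Sum>b\<in>Basis. \<eta> b * ?f b v)" for v
      using dual_sum_scale[OF \<eta> finite_Basis, of "representation Basis v"]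
      by (simp add: basis_expansion mult.commute)
    then have "\<eta> = (\<lambda>v. \<Sum>b\<in>Basis. \<eta> b * ?f b v)" by (rule ext)
    then have "r \<xi> \<eta> = r \<xi> (\<lambda>v. \<Sum>b\<in>Basis. \<eta> b * ?f b v)" by (rule arg_cong)
    also have "\<dots> = (\<Sum>b\<in>Basis. \<eta> b * r \<xi> (?f b))"
      using Sym2_sum[OF r finite_Basis, of ?f \<eta>] coord_dual by blast
    also have "\<dots> = \<eta> ?x"
      by (simp add: dual_sum_scale[OF \<eta> finite_Basis] mult.commute)
    finally show "\<eta> ?x = r \<xi> \<eta>" by simp
  qed
  have "\<exists>!x. \<forall>\<eta>\<in>dual scale. \<eta> x = r \<xi> \<eta>"
  proof (rule ex1I[of _ ?x])
    show "y = ?x" if "\<forall>\<eta>\<in>dual scale. \<eta> y = r \<xi> \<eta>" for y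
      using that x by (intro dual_separates) simp
  qed (fact x)
  from theI'[OF this] \<eta> show ?thesis by (simp add: r_sharp_def)
qed

end

end

theory Submission
  imports Defs
begin

text \<open>
  A nondegenerate symmetric form \<open>C\<close> identifies \<open>x\<close> with the functional \<open>C(-, x)\<close>; carrying \<open>C\<close>
  over to the dual space along this identification gives an invertible element of \<open>Sym\<^sup>2\<close> whose sharp
  map is the inverse of the identification. For \<open>r\<^sub>1\<close> take the form obtained from \<open>B\<close>, for \<open>r\<^sub>2\<close> the
  one obtained from \<open>B\<^sub>1 = B(-, N -)\<close>. The functional of \<open>x\<close> under \<open>B\<^sub>1\<close> is the functional of \<open>N x\<close>
  under \<open>B\<close>, so the quotient of the two sharp maps is \<open>N\<close>, and \<open>B\<close> is recovered from \<open>r\<^sub>1\<close> by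
  construction. On functionals of the form \<open>C(-, x)\<close> the equation of an s-matrix reads
  \<open>C(x, yz) = C(y, xz) + C(z, [x, y])\<close>, which is closedness of \<open>C\<close>. So \<open>r\<^sub>1\<close> and \<open>r\<^sub>2\<close> are
  s-matrices because \<open>B\<close> and \<open>B\<^sub>1\<close> are closed.

  Compatibility is where the Nijenhuis condition enters. Put \<open>P = B(x, yz)\<close>, \<open>Q = B(y, xz)\<close> and
  \<open>R = B(z, [x, y])\<close>, and let the commuting operators \<open>a\<close>, \<open>b\<close>, \<open>c\<close> replace \<open>x\<close>, \<open>y\<close>, \<open>z\<close>
  respectively by its image under \<open>N\<close>. Since \<open>N\<close> is self-adjoint, closedness of \<open>B\<close> and \<open>B\<^sub>1\<close> says
  \<open>P = Q + R\<close> and \<open>a P = b Q + c R\<close>, hence \<open>(a - b) Q = (c - a) R\<close>, while the Nijenhuis identity for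
  \<open>x z\<close>, paired with \<open>y\<close>, says \<open>(b - a) (b - c) Q = 0\<close>. Twice the bracket of \<open>r\<^sub>1\<close> and \<open>r\<^sub>2\<close>
  at the functionals of \<open>x\<close>, \<open>y\<close>, \<open>z\<close> under \<open>B\<^sub>1\<close> is
  \<open>- a (b + c) P + b (a + c) Q + c (a + b) R\<close>. Substituting for \<open>P\<close> turns this into
  \<open>- c (a - b) Q + b (c - a) R = (b - c) (a - b) Q = 0\<close>.
\<close>

section \<open>The element of the symmetric square inverse to a form\<close>

definition flat :: "('v \<Rightarrow> 'v \<Rightarrow> 'k) \<Rightarrow> 'v \<Rightarrow> 'v \<Rightarrow> 'k" where
  "flat C x = (\<lambda>v. C v x)"

definition inverse_form :: "('v \<Rightarrow> 'v \<Rightarrow> 'k) \<Rightarrow> ('v \<Rightarrow> 'k) \<Rightarrow> ('v \<Rightarrow> 'k) \<Rightarrow> 'k" where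
  "inverse_form C \<xi> \<eta> = \<eta> (inv (flat C) \<xi>)"

lemma bilinear_formD:
  assumes "bilinear_form scale C"
  shows "C (x + y) z = C x z + C y z" "C z (x + y) = C z x + C z y"
    "C (x - y) z = C x z - C y z" "C z (x - y) = C z x - C z y"
    "C (scale c x) z = c * C x z" "C z (scale c x) = c * C z x"
proof -
  interpret left: Vector_Spaces.linear scale "(*)" "\<lambda>x. C x z"
    using assms by (simp add: bilinear_form_def)
  interpret right: Vector_Spaces.linear scale "(*)" "\<lambda>x. C z x"
    using assms by (simp add: bilinear_form_def)
  show "C (x + y) z = C x z + C y z" "C z (x + y) = C z x + C z y"
    "C (x - y) z = C x z - C y z" "C z (x - y) = C z x - C z y"
    "C (scale c x) z = c * C x z" "C z (scale c x) = c * C z x"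
    by (fact left.add right.add left.diff right.diff left.scale right.scale)+
qed

context finite_dimensional_vector_space
begin

lemma flat_in_dual:
  assumes "bilinear_form scale C"
  shows "flat C x \<in> dual scale"
  unfolding flat_def by (rule dualI) (simp_all add: bilinear_formD[OF assms])

lemma dual_eqI_Basis:
  assumes "\<xi> \<in> dual scale" "\<eta> \<in> dual scale" "\<And>b. b \<in> Basis \<Longrightarrow> \<xi> b = \<eta> b"
  shows "\<xi> = \<eta>"
proof
  fix v
  have "(\<Sum>b\<in>Basis. representation Basis v b * \<xi> b) = (\<Sum>b\<in>Basis. representation Basis v b * \<eta> b)"
    using assms(3) by simp
  then show "\<xi> v = \<eta> v"
    by (simp only: dual_sum_scale[OF assms(1) finite_Basis, symmetric]
        dual_sum_scale[OF assms(2) finite_Basis, symmetric] basis_expansion)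
qed

lemma inj_flat:
  assumes "bilinear_form scale C" "symmetric_form C" "nondegenerate C"
  shows "inj (flat C)"
proof (rule injI)
  fix x y assume "flat C x = flat C y"
  then have "C v x = C v y" for v
    by (metis flat_def)
  then have "C (x - y) v = 0" for v
    using assms(2) bilinear_formD[OF assms(1)] by (simp add: symmetric_form_def)
  then show "x = y"
    using assms(3) unfolding nondegenerate_def by (metis eq_iff_diff_eq_0)
qed

text \<open>Reading off the values of a functional on the basis identifies the dual space with the space
  itself. Under this identification \<open>flat C\<close> becomes an injective endomorphism, which is surjective
  because the dimension is finite.\<close>

lemma range_flat:
  assumes "bilinear_form scale C" "symmetric_form C" "nondegenerate C"
  shows "range (flat C) = dual scale"
proof
  show "range (flat C) \<subseteq> dual scale"
    using flat_in_dual[OF assms(1)] by blast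
next
  define G where "G x = (\<Sum>b\<in>Basis. scale (C b x) b)" for x
  have coord: "representation Basis (\<Sum>b\<in>Basis. scale (f b) b) b = f b" if "b \<in> Basis" for f b
    using representation_basis[OF independent_Basis]
      dual_sum_scale[OF coord_dual finite_Basis, of f b] that finite_Basis
    by (simp add: if_distrib cong: if_cong)
  have G_values: "flat C x = \<xi>" if "\<xi> \<in> dual scale" "G x = (\<Sum>b\<in>Basis. scale (\<xi> b) b)" for x \<xi>
  proof (rule dual_eqI_Basis[OF flat_in_dual[OF assms(1)] that(1)])
    fix b assume "b \<in> Basis"
    then show "flat C x b = \<xi> b"
      using coord[of b "\<lambda>b. C b x"] coord[of b \<xi>] that(2) by (simp add: G_def flat_def)
  qed
  have linear_G: "Vector_Spaces.linear scale scale G"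
    using vector_space_axioms
    by (simp add: Vector_Spaces.linear_iff G_def bilinear_formD[OF assms(1)]
        scale_left_distrib sum.distrib scale_sum_right)
  have "inj G"
  proof (rule injI)
    fix x y assume "G x = G y"
    then have "flat C x = flat C y"
      by (intro G_values flat_in_dual[OF assms(1)]) (simp add: G_def flat_def)
    then show "x = y"
      using inj_flat[OF assms] by (simp add: inj_eq)
  qed
  then have "surj G"
    by (rule linear_inj_imp_surj[OF linear_G])
  show "dual scale \<subseteq> range (flat C)"
  proof (intro subsetI)
    fix \<xi> assume "\<xi> \<in> dual scale"
    moreover obtain x where "G x = (\<Sum>b\<in>Basis. scale (\<xi> b) b)"
      using \<open>surj G\<close> by (metis surjD)
    ultimately show "\<xi> \<in> range (flat C)"
      using G_values by blast
  qed
qed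

lemma inverse_form_Sym2:
  assumes "bilinear_form scale C" "symmetric_form C" "nondegenerate C"
  shows "inverse_form C \<in> Sym2 scale"
proof -
  have "inverse_form C \<xi> \<eta> = inverse_form C \<eta> \<xi>" if dual: "\<xi> \<in> dual scale" "\<eta> \<in> dual scale" for \<xi> \<eta>
  proof -
    obtain x y where "\<xi> = flat C x" "\<eta> = flat C y"
      using dual range_flat[OF assms] by blast
    then have "inverse_form C \<xi> \<eta> = C x y" "inverse_form C \<eta> \<xi> = C y x"
      using inj_flat[OF assms] by (simp_all add: inverse_form_def) (simp_all add: flat_def)
    then show ?thesis
      using assms(2) by (simp add: symmetric_form_def)
  qed
  then show ?thesis
    by (simp add: Sym2_def inverse_form_def)
qed

lemma r_sharp_inverse_form:
  assumes "bilinear_form scale C" "symmetric_form C" "nondegenerate C"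
  shows "r_sharp scale (inverse_form C) (flat C x) = x"
proof (rule dual_separates)
  fix \<eta> assume "\<eta> \<in> dual scale"
  then show "\<eta> (r_sharp scale (inverse_form C) (flat C x)) = \<eta> x"
    using r_sharp_eq[OF inverse_form_Sym2[OF assms] flat_in_dual[OF assms(1)]] inj_flat[OF assms]
    by (simp add: inverse_form_def)
qed

lemma invertible_inverse_form:
  assumes "bilinear_form scale C" "symmetric_form C" "nondegenerate C"
  shows "invertible_Sym2 scale (inverse_form C)"
  unfolding invertible_Sym2_def
  by (rule bij_betw_byWitness[where f' = "flat C"])
    (auto simp: r_sharp_inverse_form[OF assms] range_flat[OF assms, symmetric])

lemma r_sharp_inv_inverse_form:
  assumes "bilinear_form scale C" "symmetric_form C" "nondegenerate C"
  shows "r_sharp_inv scale (inverse_form C) x = flat C x"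
  unfolding r_sharp_inv_def
  using invertible_inverse_form[OF assms] flat_in_dual[OF assms(1)] r_sharp_inverse_form[OF assms]
  by (intro inv_into_f_eq) (auto simp: invertible_Sym2_def bij_betw_def)

end

section \<open>Closed forms and s-matrices\<close>

context pre_lie_algebra
begin

lemma closed_formD:
  assumes "bilinear_form scale C" "symmetric_form C" "closed_form pmul C"
  shows "C x (pmul y z) = C y (pmul x z) + C z (commutator pmul x y)"
proof -
  have "C (pmul x y) z - C x (pmul y z) = C (pmul y x) z - C y (pmul x z)"
    using assms(3) by (simp add: closed_form_def)
  moreover have "C z (commutator pmul x y) = C (pmul x y) z - C (pmul y x) z"
    using assms(2) by (simp add: commutator_def bilinear_formD[OF assms(1)] symmetric_form_def)
  ultimately show ?thesis
    by algebra
qed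

lemma s_matrix_inverse_form:
  assumes "bilinear_form scale C" "symmetric_form C" "nondegenerate C" "closed_form pmul C"
  shows "s_matrix scale pmul (inverse_form C)"
  unfolding s_matrix_def
proof (intro conjI ballI)
  show "inverse_form C \<in> Sym2 scale"
    by (rule inverse_form_Sym2[OF assms(1-3)])
  fix \<xi> \<eta> \<zeta> assume dual: "\<xi> \<in> dual scale" "\<eta> \<in> dual scale" "\<zeta> \<in> dual scale"
  obtain x y z where flat: "\<xi> = flat C x" "\<eta> = flat C y" "\<zeta> = flat C z"
    using dual range_flat[OF assms(1-3)] by blast
  have sym: "C v w = C w v" for v w
    using assms(2) by (simp add: symmetric_form_def)
  show "s_bracket scale pmul (inverse_form C) (inverse_form C) \<xi> \<eta> \<zeta> = 0"
    unfolding s_bracket_def Let_def flat r_sharp_inverse_form[OF assms(1-3)]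
    unfolding flat_def sym[of _ x] sym[of _ y] sym[of _ z] bilinear_formD[OF assms(1)]
      closed_formD[OF assms(1,2,4), of x y z]
    by simp
qed

end

section \<open>Compatibility from the Nijenhuis condition\<close>

context pseudo_hessian_nijenhuis_pre_lie_algebra
begin

lemma form_B: "bilinear_form scale B" "symmetric_form B" "nondegenerate B" "closed_form pmul B"
  using pseudo_hessian by (simp_all add: pseudo_hessian_structure_def)

abbreviation B1 :: "'v \<Rightarrow> 'v \<Rightarrow> 'k" where
  "B1 x y \<equiv> B x (N y)"

lemma form_B1: "bilinear_form scale B1" "symmetric_form B1" "nondegenerate B1"
proof -
  interpret N: Vector_Spaces.linear scale scale N
    using nijenhuis by (simp add: nijenhuis_operator_def)
  have "vector_space ((*) :: 'k \<Rightarrow> 'k \<Rightarrow> 'k)"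
    by unfold_locales (simp_all add: algebra_simps)
  then show "bilinear_form scale B1"
    using vector_space_axioms
    by (simp add: bilinear_form_def Vector_Spaces.linear_iff N.add N.scale bilinear_formD[OF form_B(1)])
  show "symmetric_form B1"
    unfolding symmetric_form_def
  proof (intro allI)
    show "B1 x y = B1 y x" for x y
      using form_B(2) self_adjoint[of y x] by (simp add: symmetric_form_def)
  qed
  show "nondegenerate B1"
    unfolding nondegenerate_def
  proof (intro allI impI)
    fix x assume zero: "\<forall>y. B1 x y = 0"
    have "B x z = 0" for z
      using zero[rule_format, of "inv N z"] surj_f_inv_f[OF bij_is_surj[OF invertible], of z]
      by simp
    then show "x = 0"
      using form_B(3) by (simp add: nondegenerate_def)
  qed
qed

lemma flat_B1: "flat B1 x = flat B (N x)"
  by (simp add: flat_def)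

text \<open>The relation \<open>(a - b) Q = (c - a) R\<close>: closedness of both forms determines \<open>B(N x, y z)\<close> in two
  ways.\<close>

lemma closed_pair_relation:
  "B y (pmul (N x) z) - B (N y) (pmul x z) =
     B (N z) (commutator pmul x y) - B z (commutator pmul (N x) y)"
proof -
  have "B (N x) (pmul y z) = B y (pmul (N x) z) + B z (commutator pmul (N x) y)"
    by (rule closed_formD[OF form_B(1,2,4)])
  moreover have "B (N x) (pmul y z) = B (N y) (pmul x z) + B (N z) (commutator pmul x y)"
    using closed_formD[OF form_B1(1,2) closed_B1, of x y z] by (simp add: self_adjoint)
  ultimately show ?thesis
    by algebra
qed

text \<open>The relation \<open>(b - a) (b - c) Q = 0\<close>.\<close>

lemma nijenhuis_paired:
  "B y (pmul (N x) (N z)) =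
     B (N y) (pmul (N x) z) + B (N y) (pmul x (N z)) - B (N (N y)) (pmul x z)"
proof -
  have "B y (pmul (N x) (N z)) = B y (N (pmul (N x) z + pmul x (N z) - N (pmul x z)))"
    using nijenhuis unfolding nijenhuis_operator_def by presburger
  also have "\<dots> = B (N y) (pmul (N x) z + pmul x (N z) - N (pmul x z))"
    by (simp only: self_adjoint)
  also have "\<dots> = B (N y) (pmul (N x) z) + B (N y) (pmul x (N z)) - B (N (N y)) (pmul x z)"
    by (simp add: bilinear_formD[OF form_B(1)] self_adjoint)
  finally show ?thesis .
qed

text \<open>This is \<open>a (b + c) P = b (a + c) Q + c (a + b) R\<close>, the vanishing of the bracket of the two
  elements. Closedness of \<open>B\<close> turns the left-hand side into \<open>a (b + c) (Q + R)\<close>, so that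
  \<open>a c Q + a b R = b c Q + b c R\<close> remains. Here \<open>b (c - a) R = b (a - b) Q\<close> by the relation between
  \<open>Q\<close> and \<open>R\<close> with \<open>N y\<close> for \<open>y\<close>, and the Nijenhuis identity replaces \<open>a c Q\<close> by
  \<open>b c Q + b (a - b) Q\<close>.\<close>

lemma mixed_closedness:
  "B (N x) (pmul (N y) z) + B (N x) (pmul y (N z)) =
     B (N y) (pmul (N x) z) + B (N y) (pmul x (N z))
     + B (N z) (commutator pmul (N x) y) + B (N z) (commutator pmul x (N y))"
proof -
  have "B (N x) (pmul (N y) z) = B (N y) (pmul (N x) z) + B z (commutator pmul (N x) (N y))"
    "B (N x) (pmul y (N z)) = B y (pmul (N x) (N z)) + B (N z) (commutator pmul (N x) y)"
    by (rule closed_formD[OF form_B(1,2,4)])+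
  then show ?thesis
    using closed_pair_relation[of "N y" x z] nijenhuis_paired[of y x z]
    by algebra
qed

lemma compatible_inverse_forms:
  "compatible_s_matrices scale pmul (inverse_form B) (inverse_form B1)"
  unfolding compatible_s_matrices_def
proof (intro conjI ballI)
  show "s_matrix scale pmul (inverse_form B)" "s_matrix scale pmul (inverse_form B1)"
    by (intro s_matrix_inverse_form form_B form_B1 closed_B1)+
  fix \<xi> \<eta> \<zeta> assume dual: "\<xi> \<in> dual scale" "\<eta> \<in> dual scale" "\<zeta> \<in> dual scale"
  obtain x y z where flat: "\<xi> = flat B1 x" "\<eta> = flat B1 y" "\<zeta> = flat B1 z"
    using dual range_flat[OF form_B1] by blast
  have sharp: "r_sharp scale (inverse_form B) (flat B1 v) = N v"
    "r_sharp scale (inverse_form B1) (flat B1 v) = v" for v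
    using r_sharp_inverse_form[OF form_B(1-3), of "N v"] r_sharp_inverse_form[OF form_B1, of v]
    by (simp_all only: flat_B1)
  have sym: "B v (N w) = B (N w) v" for v w
    using form_B(2) by (simp add: symmetric_form_def)
  have "- B (N x) (pmul (N y) z + pmul y (N z)) + B (N y) (pmul (N x) z + pmul x (N z))
      + B (N z) (commutator pmul (N x) y + commutator pmul x (N y)) = 0"
    using mixed_closedness[of x y z] by (simp add: bilinear_formD[OF form_B(1)] algebra_simps)
  then show "s_bracket scale pmul (inverse_form B) (inverse_form B1) \<xi> \<eta> \<zeta> = 0"
    unfolding s_bracket_def Let_def flat sharp unfolding flat_def sym[of _ x] sym[of _ y] sym[of _ z]
    by simp
qed

end

theorem proposition6p8:
  fixes scale :: "'k::{alg_closed_field, field_char_0} \<Rightarrow> 'v::ab_group_add \<Rightarrow> 'v"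
    and Basis :: "'v set"
    and pmul :: "'v \<Rightarrow> 'v \<Rightarrow> 'v"
    and B :: "'v \<Rightarrow> 'v \<Rightarrow> 'k"
    and N :: "'v \<Rightarrow> 'v"
  assumes "pseudo_hessian_nijenhuis_pre_lie_algebra scale Basis pmul B N"
  shows "\<exists>r1 r2. compatible_s_matrices scale pmul r1 r2 \<and>
           invertible_Sym2 scale r1 \<and> invertible_Sym2 scale r2 \<and>
           N = r_sharp scale r1 \<circ> r_sharp_inv scale r2 \<and>
           (\<forall>x y. B x y = r_sharp_inv scale r1 y x)"
proof -
  interpret pseudo_hessian_nijenhuis_pre_lie_algebra scale Basis pmul B N
    by (fact assms)
  show ?thesis
  proof (intro exI conjI)
    show "compatible_s_matrices scale pmul (inverse_form B) (inverse_form B1)"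
      by (rule compatible_inverse_forms)
    show "invertible_Sym2 scale (inverse_form B)" "invertible_Sym2 scale (inverse_form B1)"
      by (intro invertible_inverse_form form_B form_B1)+
    show "N = r_sharp scale (inverse_form B) \<circ> r_sharp_inv scale (inverse_form B1)"
      by (simp add: fun_eq_iff r_sharp_inv_inverse_form[OF form_B1] flat_B1
          r_sharp_inverse_form[OF form_B(1-3)])
    show "\<forall>x y. B x y = r_sharp_inv scale (inverse_form B) y x"
      by (simp add: r_sharp_inv_inverse_form[OF form_B(1-3)] flat_def)
  qed
qed

end
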